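(* Let $n\ge1$ be an integer and let $f:\mathbb{R}\to\mathbb{R}$ be an $(n+1)$-times continuously differentiable function. Suppose there exist constants $A,B,D>0$ such that $A\le f(x)\le B$ and $|f'(x)|\le D|f(x)|$ for all $x$. Let $Qf$ be the quasi-interpolant of $f$ using degree $n$ B-splines on a knot sequence $\xi$ with uniform mesh size $h$. Then for all $x$ and $y$ (in the parameter interval $D^n_\xi$), $$|\log Qf(x)-\log Qf(y)|\le M'(n,h)\,|x-y|,$$ where $$M'(n,h)=\frac{DB+C_1h^n}{A-C_2h^{n+1}},\qquad C_1=\frac{2(n+1)^{n-1}\|Q\|}{(n-1)!}\|f^{(n+1)}\|_\infty,\qquad C_2=\frac{(n+1)^{n}\|Q\|}{n!}\|f^{(n+1)}\|_\infty .$$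
   Context: B-splines: let $\xi=\{\xi_k\}$ be a finite or bi-infinite uniform knot sequence, $\xi_{k+1}-\xi_k=h>0$ (if finite, long enough that the parameter interval below is nondegenerate). Set $b^0_k(x)=1$ if $\xi_k\le x<\xi_{k+1}$ and $0$ otherwise, and for $n\ge1$ $$b^n_k=\gamma^n_k\, b^{n-1}_k+(1-\gamma^n_{k+1})\,b^{n-1}_{k+1},\qquad \gamma^n_k(x)=\frac{x-\xi_k}{\xi_{k+n}-\xi_k}.$$ The support of $b_k=b^n_k$ is $[\xi_k,\xi_{k+n+1}]$, and $k$ ranges over all indices for which $\xi_k,\dots,\xi_{k+n+1}$ are knots. The parameter interval $D^n_\xi$ is the maximal interval on which the $b^n_k$ form a partition of unity (for a finite sequence, obtained by removing the $n$ leftmost and $n$ rightmost knot intervals; for a bi-infinite sequence, $\mathbb{R}$). Quasi-interpolant: $Qf=\sum_k (Q_kf)b_k$ with $Q_kf=\sum_{v=0}^n w_v f(\xi_{k+v}+h/2)$, where the weights $w_0,\dots,w_n$ solve $$\sum_{v=0}^n w_v (v-j)^n=\prod_{i=1}^n\left(i-j-\tfrac12\right),\qquad j=0,1,\dots,n.$$ The scheme reproduces polynomials of degree at most $n$ on $D^n_\xi$. The constant $\|Q\|=\sum_{v=0}^n|w_v|$. $\|\cdot\|_\infty$ is the supremum norm over the domain of $f$.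
   Formalization: The formal theorem also assumes that f^(n+1) is bounded (so C_1, C_2 are finite) and that A - C_2 h^{n+1} > 0; if this denominator is negative the stated bound is negative and fails, if it is zero M' is undefined. *)

theory Defs
  imports "HOL-Analysis.Analysis"
begin

text \<open>
  Knots are \<open>\<xi> k\<close> with \<open>k\<close> ranging over an index set \<open>K\<close> of integers: all integers for a
  bi-infinite sequence, an interval \<open>{a..b}\<close> for a finite one. Values of \<open>\<xi>\<close> outside \<open>K\<close> are
  irrelevant. The length condition in the finite case says that removing \<open>n\<close> knot intervals
  at either end leaves at least one.
\<close>
definition uniform_knots :: "(int \<Rightarrow> real) \<Rightarrow> int set \<Rightarrow> nat \<Rightarrow> real \<Rightarrow> bool" where
  "uniform_knots \<xi> K n h \<longleftrightarrow>
     (K = UNIV \<or> (\<exists>a b. a + 2 * int n < b \<and> K = {a..b})) \<and>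
     h > 0 \<and> (\<forall>k. k \<in> K \<and> k + 1 \<in> K \<longrightarrow> \<xi> (k + 1) - \<xi> k = h)"

definition bs_gamma :: "(int \<Rightarrow> real) \<Rightarrow> nat \<Rightarrow> int \<Rightarrow> real \<Rightarrow> real" where
  "bs_gamma \<xi> n k x = (x - \<xi> k) / (\<xi> (k + int n) - \<xi> k)"

fun bspline :: "(int \<Rightarrow> real) \<Rightarrow> nat \<Rightarrow> int \<Rightarrow> real \<Rightarrow> real" where
  "bspline \<xi> 0 k x = (if \<xi> k \<le> x \<and> x < \<xi> (k + 1) then 1 else 0)"
| "bspline \<xi> (Suc n) k x =
     bs_gamma \<xi> (Suc n) k x * bspline \<xi> n k x
     + (1 - bs_gamma \<xi> (Suc n) (k + 1) x) * bspline \<xi> n (k + 1) x"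

definition bspline_indices :: "int set \<Rightarrow> nat \<Rightarrow> int set" where
  "bspline_indices K n = {k. {k..k + int n + 1} \<subseteq> K}"

text \<open>
  At each point only finitely many B-splines are nonzero, so the infinite sums below are
  pointwise finite sums.
\<close>
definition partition_of_unity_on :: "(int \<Rightarrow> real) \<Rightarrow> int set \<Rightarrow> nat \<Rightarrow> real set \<Rightarrow> bool" where
  "partition_of_unity_on \<xi> K n J \<longleftrightarrow>
     (\<forall>x\<in>J. (\<forall>k\<in>bspline_indices K n. bspline \<xi> n k x \<ge> 0) \<and>
            (\<Sum>\<^sub>\<infinity>k\<in>bspline_indices K n. bspline \<xi> n k x) = 1)"

text \<open>
  The order on sets is inclusion. For \<open>n \<ge> 1\<close> and uniform knots the greatest such interval
  exists: it is \<open>UNIV\<close> if \<open>K = UNIV\<close>, and \<open>{\<xi> (a + n)..\<xi> (b - n)}\<close> if \<open>K = {a..b}\<close>.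
\<close>
definition parameter_interval :: "(int \<Rightarrow> real) \<Rightarrow> int set \<Rightarrow> nat \<Rightarrow> real set" where
  "parameter_interval \<xi> K n =
     (GREATEST J. is_interval J \<and> partition_of_unity_on \<xi> K n J)"

definition qi_weights :: "nat \<Rightarrow> (nat \<Rightarrow> real) \<Rightarrow> bool" where
  "qi_weights n w \<longleftrightarrow>
     (\<forall>j\<in>{0..n}. (\<Sum>v=0..n. w v * (real v - real j) ^ n)
               = (\<Prod>i=1..n. real i - real j - 1 / 2))"

definition qi_functional ::
  "(int \<Rightarrow> real) \<Rightarrow> real \<Rightarrow> nat \<Rightarrow> (nat \<Rightarrow> real) \<Rightarrow> int \<Rightarrow> (real \<Rightarrow> real) \<Rightarrow> real" where
  "qi_functional \<xi> h n w k f = (\<Sum>v=0..n. w v * f (\<xi> (k + int v) + h / 2))"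

definition quasi_interpolant ::
  "(int \<Rightarrow> real) \<Rightarrow> int set \<Rightarrow> real \<Rightarrow> nat \<Rightarrow> (nat \<Rightarrow> real) \<Rightarrow> (real \<Rightarrow> real) \<Rightarrow> real \<Rightarrow> real" where
  "quasi_interpolant \<xi> K h n w f x =
     (\<Sum>\<^sub>\<infinity>k\<in>bspline_indices K n. qi_functional \<xi> h n w k f * bspline \<xi> n k x)"

definition qi_norm :: "nat \<Rightarrow> (nat \<Rightarrow> real) \<Rightarrow> real" where
  "qi_norm n w = (\<Sum>v=0..n. \<bar>w v\<bar>)"

definition times_cont_diff :: "nat \<Rightarrow> (real \<Rightarrow> real) \<Rightarrow> bool" where
  "times_cont_diff m f \<longleftrightarrow>
     (\<forall>j<m. \<forall>x. (deriv ^^ j) f differentiable (at x)) \<and> continuous_on UNIV ((deriv ^^ m) f)"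

text \<open>Only meaningful for bounded \<open>g\<close>; the supremum is taken in the reals.\<close>
definition sup_norm :: "(real \<Rightarrow> real) \<Rightarrow> real" where
  "sup_norm g = (SUP x. \<bar>g x\<bar>)"

definition C1_const :: "nat \<Rightarrow> (nat \<Rightarrow> real) \<Rightarrow> (real \<Rightarrow> real) \<Rightarrow> real" where
  "C1_const n w f =
     2 * (real n + 1) ^ (n - 1) * qi_norm n w / fact (n - 1) * sup_norm ((deriv ^^ (n + 1)) f)"

definition C2_const :: "nat \<Rightarrow> (nat \<Rightarrow> real) \<Rightarrow> (real \<Rightarrow> real) \<Rightarrow> real" where
  "C2_const n w f =
     (real n + 1) ^ n * qi_norm n w / fact n * sup_norm ((deriv ^^ (n + 1)) f)"

end

theory Submission
  imports Defs
begin

text \<open>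
The quasi-interpolant is close to \<open>f\<close> and its derivative is close to that of \<open>f\<close>. Where
\<open>\<bar>Qf - f\<bar> \<le> C2 h^(n+1)\<close> and \<open>\<bar>(Qf)' - f'\<bar> \<le> C1 h^n\<close>, the hypotheses on \<open>f\<close> give
\<open>Qf \<ge> A - C2 h^(n+1) > 0\<close> and \<open>\<bar>(Qf)'\<bar> \<le> D B + C1 h^n\<close>. So the logarithmic derivative
\<open>(Qf)' / Qf\<close> is bounded by the claimed constant. For \<open>n = 1\<close> the function \<open>Qf\<close> is only piecewise
linear, so the derivative is taken off the knots; as \<open>Qf\<close> is continuous and only finitely many knots
lie between \<open>x\<close> and \<open>y\<close>, integrating the logarithmic derivative gives the Lipschitz bound
(\<open>ln_window_spline_lipschitz\<close>).

Both error estimates rest on polynomial reproduction. The equations for the weights are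
polynomial identities in \<open>j\<close> that hold at \<open>n + 1\<close> points, hence everywhere (\<open>qi_weights_shift\<close>);
together with \<open>marsden_identity\<close> they say that \<open>Q\<close> reproduces \<open>(t - s)^n\<close> for every \<open>s\<close>. Comparing
coefficients in \<open>s\<close> gives all powers up to \<open>n\<close> (\<open>power_moments_from_shifts\<close>). Let \<open>P\<close> be the
Taylor polynomial of \<open>f\<close> of degree \<open>n\<close> at the point \<open>z\<close> of interest and \<open>g = f - P\<close>. Then the
errors of the value and of the derivative at \<open>z\<close> are \<open>Qg\<close> and \<open>(Qg)'\<close>. Only values of \<open>g\<close> within
\<open>(n + 1) h\<close> of \<open>z\<close> enter, so Taylor's theorem bounds \<open>Qg\<close>, a convex combination of the
functionals \<open>Q_k g\<close> (\<open>window_spline_error\<close>).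

For the derivative, summation by parts gives
\<open>(Qg)' = \<Sum>k. (Q_k g - Q_(k-1) g) / h * b_k^(n-1)\<close>, again a convex combination, and
\<open>Q_k g - Q_(k-1) g\<close> averages the differences \<open>g(t) - g(t - h)\<close>, which the mean value theorem bounds
through \<open>g'\<close> (\<open>window_spline_deriv_error\<close>). Estimating \<open>Q_k g\<close> and \<open>Q_(k-1) g\<close> separately by
\<open>(n + 1) h\<close> would lose a factor \<open>(n + 1) / n\<close> against \<open>C1\<close>.

A finite knot sequence is continued to an infinite arithmetic progression. On the parameter
interval this changes nothing: a point belongs to it exactly if all B-splines with an index outside
the given range vanish there (\<open>infsum_bspline_eq_1_iff\<close>, \<open>parameter_interval_eq\<close>). All sums can
therefore be taken over any finite window of indices \<open>p..q\<close> that covers the point.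
\<close>

section \<open>B-splines over strictly increasing knots\<close>

lemma bspline_cong:
  assumes "\<And>i. k \<le> i \<Longrightarrow> i \<le> k + int n + 1 \<Longrightarrow> \<xi> i = \<eta> i"
  shows "bspline \<xi> n k x = bspline \<eta> n k x"
  using assms
proof (induction n arbitrary: k)
  case 0
  then show ?case by simp
next
  case (Suc n)
  have "bspline \<xi> n k x = bspline \<eta> n k x" "bspline \<xi> n (k + 1) x = bspline \<eta> n (k + 1) x"
    by (rule Suc.IH; use Suc.prems in force)+
  moreover have "\<xi> k = \<eta> k" "\<xi> (k + int (Suc n)) = \<eta> (k + int (Suc n))"
    "\<xi> (k + 1) = \<eta> (k + 1)" "\<xi> (k + 1 + int (Suc n)) = \<eta> (k + 1 + int (Suc n))"
    by (rule Suc.prems; simp)+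
  ultimately show ?case by (simp add: bs_gamma_def)
qed

text \<open>
The recursion with the coefficient \<open>1 - \<gamma>\<close> evaluated; both coefficients are then visibly
nonnegative on the support.
\<close>
lemma bspline_Suc_eq:
  assumes "strict_mono \<xi>"
  shows "bspline \<xi> (Suc n) k x =
    (x - \<xi> k) / (\<xi> (k + int n + 1) - \<xi> k) * bspline \<xi> n k x +
    (\<xi> (k + int n + 2) - x) / (\<xi> (k + int n + 2) - \<xi> (k + 1)) * bspline \<xi> n (k + 1) x"
proof -
  have "\<xi> (k + int n + 2) - \<xi> (k + 1) \<noteq> 0"
    using strict_monoD[OF assms, of "k + 1" "k + int n + 2"] by simp
  then have "1 - (x - \<xi> (k + 1)) / (\<xi> (k + int n + 2) - \<xi> (k + 1)) =
      (\<xi> (k + int n + 2) - x) / (\<xi> (k + int n + 2) - \<xi> (k + 1))"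
    by (simp add: field_simps)
  moreover have "k + 1 + int (Suc n) = k + int n + 2" "k + int (Suc n) = k + int n + 1" by auto
  ultimately show ?thesis by (simp only: bspline.simps bs_gamma_def)
qed

declare bspline.simps(2) [simp del]

lemma bspline_eq_0:
  assumes "strict_mono \<xi>" and "x < \<xi> k \<or> \<xi> (k + int n + 1) \<le> x"
  shows "bspline \<xi> n k x = 0"
  using assms(2)
proof (induction n arbitrary: k)
  case 0
  then show ?case by auto
next
  case (Suc n)
  have "\<xi> k < \<xi> (k + 1)" "\<xi> (k + int n + 1) < \<xi> (k + int n + 2)"
    using strict_monoD[OF assms(1)] by simp_all
  moreover have "x < \<xi> k \<or> \<xi> (k + int n + 2) \<le> x" using Suc.prems by (simp add: algebra_simps)
  ultimately have "bspline \<xi> n k x = 0" "bspline \<xi> n (k + 1) x = 0"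
    by (auto intro!: Suc.IH simp: algebra_simps)
  then show ?case by (simp add: bspline.simps)
qed

text \<open>
At the left end of its support a B-spline is positive only for degree 0, which is why that case
appears in the hypothesis. In the induction step, to the left of \<open>\<xi> (k + n + 1)\<close> the first summand
of the recursion is positive, from there on the second one is.
\<close>
lemma bspline_pos:
  assumes "strict_mono \<xi>" and "\<xi> k < x \<or> n = 0 \<and> \<xi> k \<le> x" "x < \<xi> (k + int n + 1)"
  shows "bspline \<xi> n k x > 0"
  using assms(2,3)
proof (induction n arbitrary: k)
  case 0
  then show ?case by auto
next
  case (Suc n)
  have less: "\<xi> i < \<xi> j" if "i < j" for i j using strict_monoD[OF assms(1) that] .
  have nonneg: "bspline \<xi> n i x \<ge> 0" for i
  proof (cases "(\<xi> i < x \<or> n = 0 \<and> \<xi> i \<le> x) \<and> x < \<xi> (i + int n + 1)")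
    case True
    then show ?thesis using Suc.IH[of i] by simp
  next
    case False
    then consider "x < \<xi> i \<or> \<xi> (i + int n + 1) \<le> x" | "x = \<xi> i" "n \<noteq> 0" by force
    then show ?thesis
    proof cases
      case 1
      then show ?thesis using bspline_eq_0[OF assms(1)] by simp
    next
      case 2
      then obtain m where "n = Suc m" by (cases n) auto
      moreover have "bspline \<xi> m (i + 1) x = 0"
        by (rule bspline_eq_0[OF assms(1)]) (use 2 less[of i "i+1"] in auto)
      ultimately show ?thesis using 2 by (simp add: bspline_Suc_eq[OF assms(1)])
    qed
  qed
  have x: "\<xi> k < x" "x < \<xi> (k + int n + 2)" using Suc.prems by (auto simp: algebra_simps)
  have c: "(x - \<xi> k) / (\<xi> (k + int n + 1) - \<xi> k) > 0"
    "(\<xi> (k + int n + 2) - x) / (\<xi> (k + int n + 2) - \<xi> (k + 1)) > 0"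
    using x less[of k "k + int n + 1"] less[of "k + 1" "k + int n + 2"] by simp_all
  show ?case
  proof (cases "x < \<xi> (k + int n + 1)")
    case True
    then have "bspline \<xi> n k x > 0" using x by (intro Suc.IH) auto
    then show ?thesis using c nonneg[of "k+1"]
      unfolding bspline_Suc_eq[OF assms(1)]
      by (intro add_pos_nonneg mult_pos_pos mult_nonneg_nonneg) auto
  next
    case False
    have "bspline \<xi> n (k + 1) x > 0"
      using x False less[of "k + 1" "k + int n + 1"]
      by (intro Suc.IH) (cases "n = 0", auto simp: algebra_simps)
    then show ?thesis using c nonneg[of k]
      unfolding bspline_Suc_eq[OF assms(1)]
      by (intro add_nonneg_pos mult_pos_pos mult_nonneg_nonneg) auto
  qed
qed

lemma bspline_left_knot:
  assumes "strict_mono \<xi>" and "n \<ge> 1"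
  shows "bspline \<xi> n k (\<xi> k) = 0"
proof -
  obtain m where "n = Suc m" using assms(2) by (cases n) auto
  moreover have "bspline \<xi> m (k + 1) (\<xi> k) = 0"
    by (rule bspline_eq_0[OF assms(1)]) (use strict_monoD[OF assms(1), of k "k + 1"] in auto)
  ultimately show ?thesis by (simp add: bspline_Suc_eq[OF assms(1)])
qed

lemma bspline_nonneg:
  assumes "strict_mono \<xi>"
  shows "bspline \<xi> n k x \<ge> 0"
proof (cases "x < \<xi> k \<or> \<xi> (k + int n + 1) \<le> x")
  case True
  then show ?thesis using bspline_eq_0[OF assms] by simp
next
  case False
  then consider "\<xi> k < x \<or> n = 0 \<and> \<xi> k \<le> x" | "x = \<xi> k" "n \<ge> 1" by force
  then show ?thesis
  proof cases
    case 1
    show ?thesis using bspline_pos[OF assms 1] False by simp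
  next
    case 2
    then show ?thesis using bspline_left_knot[OF assms] by simp
  qed
qed

section \<open>Partition of unity and Marsden's identity\<close>

text \<open>
The two boundary conditions make the shifted sum run over the same window as the original one.
For the B-splines of degree \<open>n - 1\<close> they hold at a point as soon as the window covers all indices
whose B-spline of degree \<open>n\<close> is active there.
\<close>
lemma sum_by_parts:
  fixes a d u v :: "int \<Rightarrow> real"
  assumes "a p = 0" "a (q + 1) = 0"
  shows "(\<Sum>k=p..q. d k * (u k * a k + v (k + 1) * a (k + 1))) =
    (\<Sum>k=p..q. (d k * u k + d (k - 1) * v k) * a k)"
proof -
  have p: "a k = 0" if "p \<le> k" "\<not> p + 1 \<le> k" for k
    using that assms(1) by (cases "k = p") auto
  have q: "a k = 0" if "k \<le> q + 1" "\<not> k \<le> q" for k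
    using that assms(2) by (cases "k = q + 1") auto
  have "(\<Sum>k=p..q. d k * (v (k + 1) * a (k + 1))) = (\<Sum>k=p+1..q+1. d (k - 1) * (v k * a k))"
    by (rule sum.reindex_bij_witness[of _ "\<lambda>k. k - 1" "\<lambda>k. k + 1"]) auto
  also have "\<dots> = (\<Sum>k\<in>{p..q+1}. d (k - 1) * (v k * a k))"
    by (rule sum.mono_neutral_left) (auto simp: p)
  also have "\<dots> = (\<Sum>k=p..q. d (k - 1) * (v k * a k))"
    by (rule sum.mono_neutral_right) (auto simp: q)
  finally show ?thesis by (simp add: algebra_simps sum.distrib)
qed

lemma sum_bspline_0:
  assumes "strict_mono \<xi>" and "\<xi> p \<le> x" "x < \<xi> (q + 1)"
  shows "(\<Sum>k=p..q. bspline \<xi> 0 k x) = 1"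
proof -
  \<comment> \<open>The one active index is that of the last knot of the window not to the right of \<open>x\<close>.\<close>
  define S where "S = {k \<in> {p..q}. \<xi> k \<le> x}"
  have "p \<in> S"
    using assms(2,3) strict_mono_less[OF assms(1), of p "q + 1"] unfolding S_def by auto
  have "finite S" by (rule finite_subset[of _ "{p..q}"]) (auto simp: S_def)
  with \<open>p \<in> S\<close> have S: "finite S" "S \<noteq> {}" by auto
  define j where "j = Max S"
  have j: "j \<in> {p..q}" "\<xi> j \<le> x" using Max_in[OF S] unfolding j_def S_def by auto
  have "x < \<xi> (j + 1)"
  proof (cases "j = q")
    case False
    show ?thesis
    proof (rule ccontr)
      assume "\<not> x < \<xi> (j + 1)"
      then have "j + 1 \<in> S" using j False unfolding S_def by auto
      from Max_ge[OF S(1) this] show False unfolding j_def by simp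
    qed
  qed (use assms in simp)
  have "bspline \<xi> 0 k x = (if k = j then 1 else 0)" for k
  proof -
    have "\<xi> k \<le> x \<longleftrightarrow> k \<le> j" if "x < \<xi> (k + 1)"
      using j(2) \<open>x < \<xi> (j + 1)\<close> that strict_mono_less_eq[OF assms(1), of k j] strict_mono_less[OF assms(1), of k "j+1"]
      by (auto)
    moreover have "x < \<xi> (k + 1) \<longleftrightarrow> j \<le> k" if "\<xi> k \<le> x"
      using j(2) \<open>x < \<xi> (j + 1)\<close> that strict_mono_less_eq[OF assms(1), of "j+1" "k+1"] strict_mono_less[OF assms(1), of j "k+1"]
      by auto
    ultimately show ?thesis using j(2) \<open>x < \<xi> (j + 1)\<close> by auto
  qed
  then show ?thesis using j by (simp add: sum.delta del: bspline.simps)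
qed

text \<open>
Lowering the degree: a spline of degree \<open>n + 1\<close> is at each point a spline of degree \<open>n\<close> whose
coefficients are affine combinations of neighbouring old ones. This is one step of de Boor's
algorithm.
\<close>
lemma sum_bspline_Suc:
  assumes "strict_mono \<xi>" and "\<xi> (p + int n + 1) \<le> x" "x < \<xi> (q + 1)"
  shows "(\<Sum>k=p..q. d k * bspline \<xi> (Suc n) k x) =
    (\<Sum>k=p..q. (d k * ((x - \<xi> k) / (\<xi> (k + int n + 1) - \<xi> k)) +
      d (k - 1) * ((\<xi> (k + int n + 1) - x) / (\<xi> (k + int n + 1) - \<xi> k))) * bspline \<xi> n k x)"
proof -
  let ?u = "\<lambda>k. (x - \<xi> k) / (\<xi> (k + int n + 1) - \<xi> k)"
  let ?v = "\<lambda>k. (\<xi> (k + int n + 1) - x) / (\<xi> (k + int n + 1) - \<xi> k)"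
  have "(\<Sum>k=p..q. d k * bspline \<xi> (Suc n) k x) =
    (\<Sum>k=p..q. d k * (?u k * bspline \<xi> n k x + ?v (k + 1) * bspline \<xi> n (k + 1) x))"
    by (rule sum.cong) (simp_all add: bspline_Suc_eq[OF assms(1)] algebra_simps)
  also have "\<dots> = (\<Sum>k=p..q. (d k * ?u k + d (k - 1) * ?v k) * bspline \<xi> n k x)"
    using assms(2,3) by (intro sum_by_parts bspline_eq_0[OF assms(1)]) auto
  finally show ?thesis .
qed

lemma sum_bspline_eq_1:
  assumes "strict_mono \<xi>" and "\<xi> (p + int n) \<le> x" "x < \<xi> (q + 1)"
  shows "(\<Sum>k=p..q. bspline \<xi> n k x) = 1"
  using assms(2)
proof (induction n)
  case 0
  then show ?case using sum_bspline_0[OF assms(1) _ assms(3)] by simp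
next
  case (Suc n)
  have less: "\<xi> i < \<xi> j" if "i < j" for i j using strict_monoD[OF assms(1) that] .
  have x: "\<xi> (p + int n + 1) \<le> x" using Suc.prems by (simp add: algebra_simps)
  have "\<xi> (k + int n + 1) \<noteq> \<xi> k" for k using less[of k "k + int n + 1"] by simp
  then have "(\<Sum>k=p..q. bspline \<xi> (Suc n) k x) = (\<Sum>k=p..q. bspline \<xi> n k x)"
    using sum_bspline_Suc[OF assms(1) x assms(3), of "\<lambda>_. 1"]
    by (simp flip: add_divide_distrib)
  also have "\<xi> (p + int n) \<le> x" using x less[of "p + int n" "p + int n + 1"] by simp
  then have "(\<Sum>k=p..q. bspline \<xi> n k x) = 1" by (rule Suc.IH)
  finally show ?case .
qed

text \<open>
The induction works because the dual polynomials \<open>\<Prod>i. \<xi> (k + i) - s\<close> for \<open>k\<close> and \<open>k - 1\<close> share all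
factors but one; in one step of de Boor's algorithm their affine combination is the dual polynomial
of lower degree times \<open>x - s\<close>.
\<close>
lemma marsden_identity:
  assumes "strict_mono \<xi>" and "\<xi> (p + int n) \<le> x" "x < \<xi> (q + 1)"
  shows "(\<Sum>k=p..q. (\<Prod>i=1..n. \<xi> (k + int i) - s) * bspline \<xi> n k x) = (x - s) ^ n"
  using assms(2)
proof (induction n)
  case 0
  then show ?case using sum_bspline_0[OF assms(1) _ assms(3)] by simp
next
  case (Suc n)
  have less: "\<xi> i < \<xi> j" if "i < j" for i j using strict_monoD[OF assms(1) that] .
  let ?C = "\<lambda>n k. \<Prod>i=1..n. \<xi> (k + int i) - s"
  let ?u = "\<lambda>k. (x - \<xi> k) / (\<xi> (k + int n + 1) - \<xi> k)"
  let ?v = "\<lambda>k. (\<xi> (k + int n + 1) - x) / (\<xi> (k + int n + 1) - \<xi> k)"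
  have x: "\<xi> (p + int n + 1) \<le> x" using Suc.prems by (simp add: algebra_simps)
  have "(\<Sum>k=p..q. ?C (Suc n) k * bspline \<xi> (Suc n) k x) =
      (\<Sum>k=p..q. (?C (Suc n) k * ?u k + ?C (Suc n) (k - 1) * ?v k) * bspline \<xi> n k x)"
    by (rule sum_bspline_Suc[OF assms(1) x assms(3)])
  also have "\<dots> = (\<Sum>k=p..q. (x - s) * (?C n k * bspline \<xi> n k x))"
  proof (rule sum.cong)
    fix k
    have "?C (Suc n) k = ?C n k * (\<xi> (k + int n + 1) - s)"
      by (simp add: algebra_simps)
    moreover have "?C (Suc n) (k - 1) = (\<xi> k - s) * (\<Prod>i=Suc 1..Suc n. \<xi> (k - 1 + int i) - s)"
      by (subst prod.atLeast_Suc_atMost) (simp_all)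
    then have "?C (Suc n) (k - 1) = (\<xi> k - s) * ?C n k"
      by (simp only: prod.shift_bounds_cl_Suc_ivl) (simp add: algebra_simps)
    moreover have "(\<xi> (k + int n + 1) - s) * ?u k + (\<xi> k - s) * ?v k = x - s"
    proof -
      have "(\<xi> (k + int n + 1) - s) * (x - \<xi> k) + (\<xi> k - s) * (\<xi> (k + int n + 1) - x) =
          (x - s) * (\<xi> (k + int n + 1) - \<xi> k)"
        by (simp add: algebra_simps)
      then show ?thesis
        using less[of k "k + int n + 1"] by (simp add: divide_eq_eq flip: add_divide_distrib)
    qed
    ultimately have "?C (Suc n) k * ?u k + ?C (Suc n) (k - 1) * ?v k = ?C n k * (x - s)"
      by (simp only: distrib_left ac_simps flip: \<open>_ = x - s\<close>)
    then show "(?C (Suc n) k * ?u k + ?C (Suc n) (k - 1) * ?v k) * bspline \<xi> n k x =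
        (x - s) * (?C n k * bspline \<xi> n k x)"
      by (simp only: ac_simps)
  qed simp
  also have "\<dots> = (x - s) * (\<Sum>k=p..q. ?C n k * bspline \<xi> n k x)"
    by (simp add: sum_distrib_left)
  also have "\<xi> (p + int n) \<le> x" using x less[of "p + int n" "p + int n + 1"] by simp
  then have "(\<Sum>k=p..q. ?C n k * bspline \<xi> n k x) = (x - s) ^ n" by (rule Suc.IH)
  finally show ?case by simp
qed
text \<open>
Only the coefficients with nonzero weight matter. Combined with the local support of B-splines
this restricts the estimates below to sample points near the point of evaluation.
\<close>
lemma abs_convex_sum_le:
  fixes b d :: "'a \<Rightarrow> real"
  assumes "\<And>k. k \<in> I \<Longrightarrow> b k \<ge> 0" and "sum b I = 1" and "\<And>k. k \<in> I \<Longrightarrow> b k \<noteq> 0 \<Longrightarrow> \<bar>d k\<bar> \<le> C"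
  shows "\<bar>\<Sum>k\<in>I. d k * b k\<bar> \<le> C"
proof -
  have "\<bar>\<Sum>k\<in>I. d k * b k\<bar> \<le> (\<Sum>k\<in>I. \<bar>d k\<bar> * b k)"
    using assms(1) by (intro order.trans[OF sum_abs] sum_mono) (simp add: abs_mult)
  also have "\<dots> \<le> (\<Sum>k\<in>I. C * b k)"
    using assms(1,3) by (intro sum_mono) (metis mult_right_mono mult_zero_right order_refl)
  finally show ?thesis using assms(2) by (simp flip: sum_distrib_left)
qed

section \<open>Derivative and continuity of B-splines\<close>

text \<open>
In this normalization, proportional to the integral-normalized M-spline, the derivative of a
B-spline is a plain difference of two neighbours.
\<close>
definition scaled_bspline :: "(int \<Rightarrow> real) \<Rightarrow> nat \<Rightarrow> int \<Rightarrow> real \<Rightarrow> real" where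
  "scaled_bspline \<xi> n k x = bspline \<xi> n k x / (\<xi> (k + int n + 1) - \<xi> k)"

lemma bspline_Suc_scaled:
  assumes "strict_mono \<xi>"
  shows "bspline \<xi> (Suc n) k x = (x - \<xi> k) * scaled_bspline \<xi> n k x +
    (\<xi> (k + int n + 2) - x) * scaled_bspline \<xi> n (k + 1) x"
proof -
  have "k + 1 + int n + 1 = k + int n + 2" by simp
  then show ?thesis
    by (simp only: bspline_Suc_eq[OF assms] scaled_bspline_def times_divide_eq_left times_divide_eq_right)
qed

text \<open>
For degree \<open>0\<close> the right-hand side is \<open>0\<close> through the factor \<open>real n\<close>, so the truncated \<open>n - 1\<close> is
harmless there. In the induction step the product rule leaves two terms with a derivative. By the
recursion one degree lower each of them contains the same spline of that degree, with opposite
signs, and it cancels in the sum.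
\<close>
lemma bspline_has_field_derivative:
  assumes "strict_mono \<xi>" and "x \<notin> range \<xi>"
  shows "(bspline \<xi> n k has_field_derivative
    real n * (scaled_bspline \<xi> (n - 1) k x - scaled_bspline \<xi> (n - 1) (k + 1) x)) (at x)"
proof (induction n arbitrary: k)
  case 0
  have "x < \<xi> k \<or> x \<in> {\<xi> k<..<\<xi> (k + 1)} \<or> \<xi> (k + 1) < x"
    using assms(2) by (metis greaterThanLessThan_iff linorder_less_linear rangeI)
  then obtain U c where U: "open U" "x \<in> U" "\<And>y. y \<in> U \<Longrightarrow> bspline \<xi> 0 k y = c"
  proof (elim disjE)
    assume "x < \<xi> k"
    then show thesis by (intro that[of "{..<\<xi> k}" 0]) auto
  next
    assume "x \<in> {\<xi> k<..<\<xi> (k + 1)}"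
    then show thesis by (intro that[of "{\<xi> k<..<\<xi> (k + 1)}" 1]) auto
  next
    assume "\<xi> (k + 1) < x"
    then show thesis by (intro that[of "{\<xi> (k + 1)<..}" 0]) auto
  qed
  have "((\<lambda>y. c) has_field_derivative 0) (at x)" by simp
  then have "(bspline \<xi> 0 k has_field_derivative 0) (at x)"
    by (rule has_field_derivative_transform_within_open[OF _ U(1,2)]) (erule U(3)[symmetric])
  then show ?case by (simp del: bspline.simps)
next
  case (Suc n)
  have less: "\<xi> i < \<xi> j" if "i < j" for i j using strict_monoD[OF assms(1) that] .
  let ?N = "scaled_bspline \<xi> n" and ?M = "scaled_bspline \<xi> (n - 1)"
  have D: "(?N i has_field_derivative
      real n * (?M i x - ?M (i + 1) x) / (\<xi> (i + int n + 1) - \<xi> i)) (at x)" for i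
    unfolding scaled_bspline_def[of \<xi> n, abs_def]
    by (rule DERIV_cdivide[OF Suc.IH])
  have left: "(x - \<xi> k) * (real n * (?M k x - ?M (k + 1) x) / (\<xi> (k + int n + 1) - \<xi> k)) =
      real n * (?N k x - ?M (k + 1) x)"
    and right: "(\<xi> (k + int n + 2) - x) *
        (real n * (?M (k + 1) x - ?M (k + 2) x) / (\<xi> (k + int n + 2) - \<xi> (k + 1))) =
      real n * (?M (k + 1) x - ?N (k + 1) x)"
    if n0: "n \<noteq> 0"
  proof -
    obtain m where m: "n = Suc m" using n0 by (cases n) auto
    have N: "?N i x * (\<xi> (i + int n + 1) - \<xi> i) =
        (x - \<xi> i) * ?M i x + (\<xi> (i + int n + 1) - x) * ?M (i + 1) x" for i
    proof -
      have "?N i x * (\<xi> (i + int n + 1) - \<xi> i) = bspline \<xi> (Suc m) i x"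
        using less[of i "i + int n + 1"] by (simp add: scaled_bspline_def m)
      moreover have "i + int m + 2 = i + int n + 1" "n - 1 = m" by (simp_all add: m)
      ultimately show ?thesis by (simp only: bspline_Suc_scaled[OF assms(1)])
    qed
    have "(x - \<xi> k) * (?M k x - ?M (k + 1) x) =
        (?N k x - ?M (k + 1) x) * (\<xi> (k + int n + 1) - \<xi> k)"
      using N[of k] by (simp add: algebra_simps)
    then show "(x - \<xi> k) * (real n * (?M k x - ?M (k + 1) x) / (\<xi> (k + int n + 1) - \<xi> k)) =
      real n * (?N k x - ?M (k + 1) x)"
      using less[of k "k + int n + 1"] by (simp add: divide_eq_eq mult.left_commute)
    have "k + 1 + int n + 1 = k + int n + 2" "k + 1 + 1 = k + 2" by auto
    with N[of "k + 1"] have "(\<xi> (k + int n + 2) - x) * (?M (k + 1) x - ?M (k + 2) x) =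
        (?M (k + 1) x - ?N (k + 1) x) * (\<xi> (k + int n + 2) - \<xi> (k + 1))"
      by (simp add: algebra_simps)
    then show "(\<xi> (k + int n + 2) - x) *
        (real n * (?M (k + 1) x - ?M (k + 2) x) / (\<xi> (k + int n + 2) - \<xi> (k + 1))) =
      real n * (?M (k + 1) x - ?N (k + 1) x)"
      using less[of "k + 1" "k + int n + 2"] by (simp add: divide_eq_eq mult.left_commute)
  qed
  have idx: "k + 1 + int n + 1 = k + int n + 2" "k + 1 + 1 = k + 2" by auto
  have eq: "bspline \<xi> (Suc n) k =
      (\<lambda>x. (x - \<xi> k) * ?N k x + (\<xi> (k + int n + 2) - x) * ?N (k + 1) x)"
    by (rule ext) (rule bspline_Suc_scaled[OF assms(1)])
  have lin: "((\<lambda>x. x - c) has_field_derivative 1) (at x)"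
    "((\<lambda>x. c - x) has_field_derivative - 1) (at x)" for c :: real
    by (auto intro!: derivative_eq_intros)
  have "(bspline \<xi> (Suc n) k has_field_derivative
      ((x - \<xi> k) * (real n * (?M k x - ?M (k + 1) x) / (\<xi> (k + int n + 1) - \<xi> k)) + 1 * ?N k x) +
      ((\<xi> (k + int n + 2) - x) *
        (real n * (?M (k + 1) x - ?M (k + 2) x) / (\<xi> (k + int n + 2) - \<xi> (k + 1))) +
        - 1 * ?N (k + 1) x)) (at x)"
    unfolding eq
    using DERIV_add[OF DERIV_mult'[OF lin(1)[of "\<xi> k"] D[of k]]
      DERIV_mult'[OF lin(2)[of "\<xi> (k + int n + 2)"] D[of "k + 1", unfolded idx]]] .
  also have "((x - \<xi> k) * (real n * (?M k x - ?M (k + 1) x) / (\<xi> (k + int n + 1) - \<xi> k)) + 1 * ?N k x) +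
      ((\<xi> (k + int n + 2) - x) *
        (real n * (?M (k + 1) x - ?M (k + 2) x) / (\<xi> (k + int n + 2) - \<xi> (k + 1))) +
        - 1 * ?N (k + 1) x) = real (Suc n) * (?N k x - ?N (k + 1) x)"
  proof (cases "n = 0")
    case False
    show ?thesis
      unfolding left[OF False] right[OF False] by (simp add: algebra_simps)
  qed simp
  finally show ?case by simp
qed

lemma continuous_on_bspline:
  assumes "strict_mono \<xi>" and "n \<ge> 1"
  shows "continuous_on S (bspline \<xi> n k)"
proof -
  obtain m where n: "n = Suc m" using assms(2) by (cases n) auto
  have "continuous_on UNIV (bspline \<xi> (Suc m) k)"
  proof (induction m arbitrary: k)
    case 0
    have "\<xi> k < \<xi> (k + 1)" "\<xi> (k + 1) < \<xi> (k + 2)"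
      using strict_monoD[OF assms(1)] by simp_all
    then have d: "\<xi> (k + 1) - \<xi> k > 0" "\<xi> (k + 2) - \<xi> (k + 1) > 0" by simp_all
    have "bspline \<xi> (Suc 0) k x = max 0
        (min ((x - \<xi> k) / (\<xi> (k + 1) - \<xi> k)) ((\<xi> (k + 2) - x) / (\<xi> (k + 2) - \<xi> (k + 1))))" for x
    proof -
      \<comment> \<open>The hat function is the positive part of the minimum of its two linear pieces.\<close>
      define u v where "u = (x - \<xi> k) / (\<xi> (k + 1) - \<xi> k)"
        and "v = (\<xi> (k + 2) - x) / (\<xi> (k + 2) - \<xi> (k + 1))"
      have "0 \<le> u \<longleftrightarrow> \<xi> k \<le> x" "1 \<le> u \<longleftrightarrow> \<xi> (k + 1) \<le> x"
        "0 < v \<longleftrightarrow> x < \<xi> (k + 2)" "v \<le> 1 \<longleftrightarrow> \<xi> (k + 1) \<le> x"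
        using d unfolding u_def v_def
        by (simp_all add: zero_le_divide_iff zero_less_divide_iff le_divide_eq divide_le_eq)
      moreover have "bspline \<xi> (Suc 0) k x = u * (if \<xi> k \<le> x \<and> x < \<xi> (k + 1) then 1 else 0) +
          v * (if \<xi> (k + 1) \<le> x \<and> x < \<xi> (k + 2) then 1 else 0)"
        by (simp add: bspline_Suc_eq[OF assms(1)] u_def v_def add.commute)
      ultimately have "bspline \<xi> (Suc 0) k x = max 0 (min u v)"
        using d by (auto simp: min_def max_def)
      then show ?thesis by (simp only: u_def v_def)
    qed
    then have "bspline \<xi> (Suc 0) k = (\<lambda>x. max 0
        (min ((x - \<xi> k) / (\<xi> (k + 1) - \<xi> k)) ((\<xi> (k + 2) - x) / (\<xi> (k + 2) - \<xi> (k + 1)))))"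
      by (rule ext)
    then show ?case using d by (auto intro!: continuous_intros)
  next
    case (Suc m)
    show ?case
      unfolding bspline_Suc_eq[OF assms(1), of "Suc m", abs_def]
      by (intro continuous_intros Suc.IH ballI)
        (use strict_monoD[OF assms(1), of k "k + int (Suc m) + 1"]
          strict_monoD[OF assms(1), of "k + 1" "k + int (Suc m) + 2"] in auto)
  qed
  then show ?thesis unfolding n by (rule continuous_on_subset) simp
qed

section \<open>Taylor polynomials\<close>

text \<open>
\<open>F j\<close> stands for the derivative of order \<open>j\<close>, and \<open>m\<close> counts the terms, so the degree is
\<open>m - 1\<close>.
\<close>
definition taylor_poly :: "(nat \<Rightarrow> real \<Rightarrow> real) \<Rightarrow> nat \<Rightarrow> real \<Rightarrow> real \<Rightarrow> real" where
  "taylor_poly F m x t = (\<Sum>j<m. F j x / fact j * (t - x) ^ j)"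

lemma taylor_poly_remainder:
  assumes "\<And>j t. j < m \<Longrightarrow> (F j has_field_derivative F (Suc j) t) (at t)"
    and "\<And>t. \<bar>F m t\<bar> \<le> M"
  shows "\<bar>F 0 t - taylor_poly F m x t\<bar> \<le> M / fact m * \<bar>t - x\<bar> ^ m"
proof -
  have "((\<lambda>u. F j (x + u)) has_field_derivative F (Suc j) (x + u)) (at u)" if "j < m" for j u
    using DERIV_shift[of "F j" "F (Suc j) (x + u)" u x] assms(1)[OF that, of "x + u"]
    by (simp add: add.commute)
  then obtain u where u: "F 0 (x + (t - x)) =
      (\<Sum>j<m. F j (x + 0) / fact j * (t - x) ^ j) + F m (x + u) / fact m * (t - x) ^ m"
    using Maclaurin_bi_le[of "\<lambda>j u. F j (x + u)" "\<lambda>u. F 0 (x + u)" m "t - x"] by auto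
  then have "\<bar>F 0 t - taylor_poly F m x t\<bar> = \<bar>F m (x + u)\<bar> / fact m * \<bar>t - x\<bar> ^ m"
    by (simp add: taylor_poly_def abs_mult power_abs)
  also have "\<dots> \<le> M / fact m * \<bar>t - x\<bar> ^ m"
    using assms(2) by (intro mult_right_mono divide_right_mono) auto
  finally show ?thesis .
qed

lemma taylor_poly_has_field_derivative:
  "(taylor_poly F (Suc m) x has_field_derivative taylor_poly (\<lambda>j. F (Suc j)) m x t) (at t)"
proof -
  have "taylor_poly F (Suc m) x = (\<lambda>t. F 0 x + (\<Sum>j<m. F (Suc j) x / fact (Suc j) * (t - x) ^ Suc j))"
    unfolding taylor_poly_def[abs_def] sum.lessThan_Suc_shift by simp
  moreover have "((\<lambda>t. F (Suc j) x / fact (Suc j) * (t - x) ^ Suc j) has_field_derivative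
      F (Suc j) x / fact j * (t - x) ^ j) (at t)" for j
  proof -
    have "((\<lambda>t. F (Suc j) x / fact (Suc j) * (t - x) ^ Suc j) has_field_derivative
      F (Suc j) x / fact (Suc j) * (real (Suc j) * (t - x) ^ j)) (at t)"
      by (rule derivative_eq_intros refl | simp del: fact_Suc)+
    also have "F (Suc j) x / fact (Suc j) * (real (Suc j) * (t - x) ^ j) =
        F (Suc j) x / fact j * (t - x) ^ j"
      by (simp add: field_simps del: of_nat_Suc)
    finally show ?thesis .
  qed
  then have "((\<lambda>t. F 0 x + (\<Sum>j<m. F (Suc j) x / fact (Suc j) * (t - x) ^ Suc j)) has_field_derivative
      0 + (\<Sum>j<m. F (Suc j) x / fact j * (t - x) ^ j)) (at t)"
    by (intro DERIV_add DERIV_const DERIV_sum)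
  ultimately show ?thesis by (simp only: taylor_poly_def add_0)
qed

lemma taylor_poly_self: "taylor_poly F (Suc m) x x = F 0 x"
  unfolding taylor_poly_def sum.lessThan_Suc_shift by simp

section \<open>Weights of the quasi-interpolant\<close>

text \<open>
Both sides are polynomials in \<open>t\<close> of degree at most \<open>n\<close>, and the weights are chosen to make them
agree at the \<open>n + 1\<close> points \<open>t = 0, ..., n\<close>.
\<close>
lemma qi_weights_shift:
  assumes "qi_weights n w"
  shows "(\<Sum>v=0..n. w v * (real v - t) ^ n) = (\<Prod>i=1..n. real i - t - 1 / 2)"
proof -
  define P where "P = (\<Sum>v=0..n. smult (w v) ([:real v, -1:] ^ n))"
  define R :: "real poly" where "R = (\<Prod>i=1..n. [:real i - 1 / 2, -1:])"
  have P: "poly P t = (\<Sum>v=0..n. w v * (real v - t) ^ n)"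
    and R: "poly R t = (\<Prod>i=1..n. real i - t - 1 / 2)" for t
    by (simp_all add: P_def R_def poly_sum poly_prod algebra_simps)
  have "degree P \<le> n" unfolding P_def
    by (intro degree_sum_le) (auto intro!: order.trans[OF degree_smult_le] order.trans[OF degree_power_le])
  moreover have "degree R \<le> n" unfolding R_def
    by (rule order.trans[OF degree_prod_sum_le]) auto
  moreover have "card (real ` {0..n}) = n + 1" by (simp add: card_image)
  ultimately have "P = R"
    using assms by (intro poly_eqI_degree[of "real ` {0..n}"]) (auto simp: P R qi_weights_def)
  then show ?thesis using P[of t] R[of t] by simp
qed

text \<open>
A functional that is a linear combination of point evaluations is exact on polynomials of degree
at most \<open>n\<close> once it is exact on the translates of the top power: the translates span that space.
\<close>
lemma power_moments_from_shifts:
  fixes c t :: "'a \<Rightarrow> real"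
  assumes "\<And>s. (\<Sum>i\<in>T. c i * (t i - s) ^ n) = (z - s) ^ n" and "j \<le> n"
  shows "(\<Sum>i\<in>T. c i * (t i - x) ^ j) = (z - x) ^ j"
proof -
  \<comment> \<open>Translates are centred at \<open>x\<close>, so that the coefficients in \<open>s\<close> are the moments about \<open>x\<close>.\<close>
  have expand: "(u - (x - s)) ^ n = (\<Sum>j\<le>n. (of_nat (n choose j) * (u - x) ^ (n - j)) * s ^ j)" for u s :: real
    using binomial_ring[of s "u - x" n] by (simp add: algebra_simps)
  have "(\<Sum>j\<le>n. (of_nat (n choose j) * (\<Sum>i\<in>T. c i * (t i - x) ^ (n - j))) * s ^ j) =
      (\<Sum>j\<le>n. (of_nat (n choose j) * (z - x) ^ (n - j)) * s ^ j)" for s :: real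
  proof -
    have "(\<Sum>j\<le>n. (of_nat (n choose j) * (\<Sum>i\<in>T. c i * (t i - x) ^ (n - j))) * s ^ j) =
      (\<Sum>j\<le>n. \<Sum>i\<in>T. c i * ((of_nat (n choose j) * (t i - x) ^ (n - j)) * s ^ j))"
      by (simp add: sum_distrib_left sum_distrib_right algebra_simps)
    also have "\<dots> = (\<Sum>i\<in>T. c i * (t i - (x - s)) ^ n)"
      by (subst sum.swap) (simp only: expand sum_distrib_left)
    also have "\<dots> = (z - (x - s)) ^ n" by (rule assms(1))
    also have "\<dots> = (\<Sum>j\<le>n. (of_nat (n choose j) * (z - x) ^ (n - j)) * s ^ j)"
      by (rule expand)
    finally show ?thesis .
  qed
  then have "\<forall>j\<le>n. of_nat (n choose j) * (\<Sum>i\<in>T. c i * (t i - x) ^ (n - j)) =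
      of_nat (n choose j) * (z - x) ^ (n - j)"
    by (intro polyfun_eq_coeffs[THEN iffD1] allI)
  from this[rule_format, of "n - j"] show ?thesis using assms(2) by auto
qed
lemma qi_functional_bound:
  assumes "\<And>v. v \<le> n \<Longrightarrow> \<bar>g (\<eta> (k + int v) + h / 2)\<bar> \<le> C"
  shows "\<bar>qi_functional \<eta> h n w k g\<bar> \<le> qi_norm n w * C"
proof -
  have "\<bar>qi_functional \<eta> h n w k g\<bar> \<le> (\<Sum>v=0..n. \<bar>w v\<bar> * \<bar>g (\<eta> (k + int v) + h / 2)\<bar>)"
    unfolding qi_functional_def by (rule order.trans[OF sum_abs]) (simp add: abs_mult)
  also have "\<dots> \<le> (\<Sum>v=0..n. \<bar>w v\<bar> * C)"
    using assms by (intro sum_mono mult_left_mono) auto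
  finally show ?thesis by (simp add: qi_norm_def sum_distrib_right)
qed

section \<open>Quasi-interpolation on infinite uniform knots\<close>

locale uniform_bsplines =
  fixes \<eta> :: "int \<Rightarrow> real" and c h :: real and n :: nat
  assumes knots: "\<eta> k = c + h * of_int k" and h_pos: "h > 0" and n_pos: "n \<ge> 1"
begin

lemma strict_mono_knots: "strict_mono \<eta>"
  by (rule strict_monoI) (simp add: knots h_pos)

lemma finite_knots: "finite (range \<eta> \<inter> {x..y})"
proof -
  have "range \<eta> \<inter> {x..y} \<subseteq> \<eta> ` {\<lfloor>(x - c) / h\<rfloor>..\<lceil>(y - c) / h\<rceil>}"
  proof (clarify, rule imageI)
    fix k assume "\<eta> k \<in> {x..y}"
    then have "(x - c) / h \<le> of_int k" "of_int k \<le> (y - c) / h"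
      using h_pos by (simp_all add: knots field_simps)
    then show "k \<in> {\<lfloor>(x - c) / h\<rfloor>..\<lceil>(y - c) / h\<rceil>}"
      by (simp add: floor_le_iff le_ceiling_iff)
  qed
  then show ?thesis by (rule finite_subset) simp
qed

end

locale uniform_quasi_interpolation = uniform_bsplines +
  fixes w :: "nat \<Rightarrow> real"
  assumes weights: "qi_weights n w"
begin

abbreviation node_functional where "node_functional \<equiv> qi_functional \<eta> h n w"

text \<open>
The quasi-interpolant restricted to the indices \<open>p..q\<close>. For points in
\<open>{\<eta> (p + n)..<\<eta> (q + 1)}\<close> every active index lies in the window, so there this finite sum is the
full quasi-interpolant.
\<close>
definition window_spline :: "int \<Rightarrow> int \<Rightarrow> (real \<Rightarrow> real) \<Rightarrow> real \<Rightarrow> real" where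
  "window_spline p q f z = (\<Sum>k=p..q. node_functional k f * bspline \<eta> n k z)"

text \<open>
After rescaling to unit mesh this is the defining property of the weights. The value is the
coefficient of \<open>b_k\<close> in Marsden's identity.
\<close>
lemma node_functional_shifted_power:
  "node_functional k (\<lambda>t. (t - s) ^ n) = (\<Prod>i=1..n. \<eta> (k + int i) - s)"
proof -
  \<comment> \<open>The half takes up the offset of the sample points, which lie midway between knots.\<close>
  define \<tau> where "\<tau> = (s - \<eta> k) / h - 1 / 2"
  have "node_functional k (\<lambda>t. (t - s) ^ n) = (\<Sum>v=0..n. h ^ n * (w v * (real v - \<tau>) ^ n))"
    unfolding qi_functional_def
  proof (rule sum.cong)
    fix v
    have "\<eta> (k + int v) + h / 2 - s = h * (real v - \<tau>)"
      using h_pos by (simp add: knots \<tau>_def field_simps)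
    then show "w v * (\<eta> (k + int v) + h / 2 - s) ^ n = h ^ n * (w v * (real v - \<tau>) ^ n)"
      by (simp add: power_mult_distrib)
  qed simp
  also have "\<dots> = h ^ n * (\<Prod>i=1..n. real i - \<tau> - 1 / 2)"
    by (simp add: qi_weights_shift[OF weights] flip: sum_distrib_left)
  also have "\<dots> = (\<Prod>i=1..n. h * (real i - \<tau> - 1 / 2))"
    by (simp add: prod.distrib)
  also have "\<dots> = (\<Prod>i=1..n. \<eta> (k + int i) - s)"
    using h_pos by (intro prod.cong) (simp_all add: knots \<tau>_def field_simps)
  finally show ?thesis .
qed

lemma window_spline_reproduces_power:
  assumes "\<eta> (p + int n) \<le> z" "z < \<eta> (q + 1)" and "j \<le> n"
  shows "window_spline p q (\<lambda>t. (t - x) ^ j) z = (z - x) ^ j"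
proof -
  have as_sum: "window_spline p q g z =
      (\<Sum>(k, v)\<in>{p..q} \<times> {0..n}. w v * bspline \<eta> n k z * g (\<eta> (k + int v) + h / 2))" for g
    by (simp add: window_spline_def qi_functional_def sum_distrib_left ac_simps flip: sum.cartesian_product)
  have "(\<Sum>(k, v)\<in>{p..q} \<times> {0..n}. w v * bspline \<eta> n k z * (\<eta> (k + int v) + h / 2 - s) ^ n) =
      (z - s) ^ n" for s
    using marsden_identity[OF strict_mono_knots assms(1,2), of s] as_sum[of "\<lambda>t. (t - s) ^ n"]
    by (simp add: window_spline_def node_functional_shifted_power)
  then show ?thesis
    using power_moments_from_shifts[where c = "\<lambda>(k, v). w v * bspline \<eta> n k z"
        and t = "\<lambda>(k, v). \<eta> (k + int v) + h / 2" and T = "{p..q} \<times> {0..n}" and n = n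
        and z = z and j = j and x = x] \<open>j \<le> n\<close>
    by (simp add: as_sum case_prod_unfold)
qed

lemma window_spline_diff:
  "window_spline p q (\<lambda>t. f t - g t) z = window_spline p q f z - window_spline p q g z"
  by (simp add: window_spline_def qi_functional_def algebra_simps sum_subtractf)

lemma window_spline_taylor_poly:
  assumes "\<eta> (p + int n) \<le> z" "z < \<eta> (q + 1)"
  shows "window_spline p q (taylor_poly F (Suc n) x) z = taylor_poly F (Suc n) x z"
proof -
  have "node_functional k (taylor_poly F (Suc n) x) =
      (\<Sum>j<Suc n. F j x / fact j * node_functional k (\<lambda>t. (t - x) ^ j))" for k
    unfolding qi_functional_def taylor_poly_def sum_distrib_left
    by (subst sum.swap) (simp only: mult.left_commute)
  then have "window_spline p q (taylor_poly F (Suc n) x) z =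
      (\<Sum>k=p..q. \<Sum>j<Suc n. F j x / fact j * (node_functional k (\<lambda>t. (t - x) ^ j) * bspline \<eta> n k z))"
    by (simp only: window_spline_def sum_distrib_right mult.assoc)
  also have "\<dots> = (\<Sum>j<Suc n. F j x / fact j * window_spline p q (\<lambda>t. (t - x) ^ j) z)"
    by (subst sum.swap) (simp only: window_spline_def sum_distrib_left)
  also have "\<dots> = taylor_poly F (Suc n) x z"
    unfolding taylor_poly_def
    by (intro sum.cong) (simp_all add: window_spline_reproduces_power[OF assms])
  finally show ?thesis .
qed

text \<open>
By reproduction the error at \<open>z\<close> is the quasi-interpolant of the Taylor remainder at \<open>z\<close>. If
\<open>b_k\<close> does not vanish at \<open>z\<close>, then \<open>z\<close> and all samples used by the functional of index \<open>k\<close> lie in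
an interval of length \<open>(n + 1) h\<close>.
\<close>
lemma window_spline_error:
  assumes F: "\<And>j t. j \<le> n \<Longrightarrow> (F j has_field_derivative F (Suc j) t) (at t)"
    and M: "\<And>t. \<bar>F (Suc n) t\<bar> \<le> M"
    and z: "\<eta> (p + int n) \<le> z" "z < \<eta> (q + 1)"
  shows "\<bar>window_spline p q (F 0) z - F 0 z\<bar> \<le>
    qi_norm n w * (M / fact (Suc n) * ((real n + 1) * h) ^ Suc n)"
proof -
  let ?g = "\<lambda>t. F 0 t - taylor_poly F (Suc n) z t"
  have "M \<ge> 0" using M[of 0] by linarith
  have "\<bar>window_spline p q ?g z\<bar> \<le> qi_norm n w * (M / fact (Suc n) * ((real n + 1) * h) ^ Suc n)"
    unfolding window_spline_def
  proof (rule abs_convex_sum_le)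
    show "(\<Sum>k=p..q. bspline \<eta> n k z) = 1" by (rule sum_bspline_eq_1[OF strict_mono_knots z])
    fix k
    assume "bspline \<eta> n k z \<noteq> 0"
    then have k: "\<eta> k \<le> z" "z \<le> \<eta> (k + int n + 1)"
      using bspline_eq_0[OF strict_mono_knots, of z k n] by force+
    show "\<bar>node_functional k ?g\<bar> \<le> qi_norm n w * (M / fact (Suc n) * ((real n + 1) * h) ^ Suc n)"
    proof (rule qi_functional_bound)
      fix v assume "v \<le> n"
      define t where "t = \<eta> (k + int v) + h / 2"
      have "h * real v \<le> h * real n" "0 \<le> h * real v" using \<open>v \<le> n\<close> h_pos by simp_all
      moreover have "t = \<eta> k + h * real v + h / 2" "\<eta> (k + int n + 1) = \<eta> k + h * real n + h"
        "(real n + 1) * h = h * real n + h"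
        by (simp_all add: t_def knots algebra_simps)
      ultimately have "\<bar>t - z\<bar> \<le> (real n + 1) * h"
        using k h_pos unfolding abs_le_iff by linarith
      have "\<bar>?g t\<bar> \<le> M / fact (Suc n) * \<bar>t - z\<bar> ^ Suc n"
        by (rule taylor_poly_remainder) (use F M in simp_all)
      also have "\<dots> \<le> M / fact (Suc n) * ((real n + 1) * h) ^ Suc n"
        using \<open>M \<ge> 0\<close> \<open>\<bar>t - z\<bar> \<le> _\<close> by (intro mult_left_mono power_mono) auto
      finally show "\<bar>?g (\<eta> (k + int v) + h / 2)\<bar> \<le> M / fact (Suc n) * ((real n + 1) * h) ^ Suc n"
        unfolding t_def .
    qed
  qed (simp add: bspline_nonneg[OF strict_mono_knots])
  then show ?thesis
    by (simp add: window_spline_diff window_spline_taylor_poly[OF z] taylor_poly_self)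
qed

text \<open>
The differentiated spline after summation by parts. This formula, rather than \<open>deriv\<close>, also gives a
value at the knots, where the derivative need not exist.
\<close>
definition window_spline_deriv :: "int \<Rightarrow> int \<Rightarrow> (real \<Rightarrow> real) \<Rightarrow> real \<Rightarrow> real" where
  "window_spline_deriv p q f z =
    (\<Sum>k=p..q. (node_functional k f - node_functional (k - 1) f) / h * bspline \<eta> (n - 1) k z)"

text \<open>
For uniform knots the factors \<open>n / (\<eta> (k + n) - \<eta> k)\<close> in the derivative of \<open>b_k\<close> are all
\<open>1 / h\<close>; summation by parts moves the difference from the B-splines to the coefficients.
\<close>
lemma window_spline_has_field_derivative:
  assumes z: "\<eta> (p + int n) \<le> z" "z < \<eta> (q + 1)" and "z \<notin> range \<eta>"
  shows "(window_spline p q f has_field_derivative window_spline_deriv p q f z) (at z)"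
proof -
  let ?b = "\<lambda>k. bspline \<eta> (n - 1) k z"
  have scaled: "real n * scaled_bspline \<eta> (n - 1) k z = ?b k / h" for k
    using n_pos h_pos by (simp add: scaled_bspline_def knots of_nat_diff field_simps)
  have "(bspline \<eta> n k has_field_derivative (?b k - ?b (k + 1)) / h) (at z)" for k
    using bspline_has_field_derivative[OF strict_mono_knots assms(3), of n k]
    by (simp only: right_diff_distrib scaled diff_divide_distrib)
  then have "(window_spline p q f has_field_derivative
      (\<Sum>k=p..q. node_functional k f * ((?b k - ?b (k + 1)) / h))) (at z)"
    unfolding window_spline_def[abs_def] by (intro DERIV_sum DERIV_cmult)
  also have "(\<Sum>k=p..q. node_functional k f * ((?b k - ?b (k + 1)) / h)) =
      (\<Sum>k=p..q. node_functional k f * (1 / h * ?b k + (- 1 / h) * ?b (k + 1)))"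
    by (simp add: diff_divide_distrib)
  also have "\<dots> = (\<Sum>k=p..q. (node_functional k f * (1 / h) + node_functional (k - 1) f * (- 1 / h)) * ?b k)"
  proof (rule sum_by_parts)
    show "?b p = 0" "?b (q + 1) = 0"
      using z n_pos by (auto intro!: bspline_eq_0[OF strict_mono_knots] simp: of_nat_diff)
  qed
  also have "\<dots> = window_spline_deriv p q f z"
    by (simp add: window_spline_deriv_def diff_divide_distrib)
  finally show ?thesis .
qed

text \<open>
The functionals for \<open>k\<close> and \<open>k - 1\<close> use the same weights and samples that differ by \<open>h\<close>. Hence
their difference on the Taylor remainder \<open>g\<close> is controlled by \<open>h\<close> times the size of \<open>g'\<close>, which cancels
the \<open>1 / h\<close> from differentiation.
\<close>
lemma window_spline_deriv_error:
  assumes F: "\<And>j t. j \<le> n \<Longrightarrow> (F j has_field_derivative F (Suc j) t) (at t)"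
    and M: "\<And>t. \<bar>F (Suc n) t\<bar> \<le> M"
    and z: "\<eta> (p + int n) \<le> z" "z < \<eta> (q + 1)" "z \<notin> range \<eta>"
  shows "\<bar>window_spline_deriv p q (F 0) z - F 1 z\<bar> \<le>
    qi_norm n w * (M / fact n * ((real n + 1) * h) ^ n)"
proof -
  let ?P = "taylor_poly F (Suc n) z" and ?P' = "taylor_poly (\<lambda>j. F (Suc j)) n z"
  let ?g = "\<lambda>t. F 0 t - ?P t" and ?g' = "\<lambda>t. F 1 t - ?P' t"
  define G where "G = M / fact n * ((real n + 1) * h) ^ n"
  have "M \<ge> 0" using M[of 0] by linarith
  have deriv_g: "(?g has_field_derivative ?g' t) (at t)" for t
    using DERIV_diff[OF F[of 0 t] taylor_poly_has_field_derivative[of F n z t]] by simp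
  have bound_g: "\<bar>?g' t\<bar> \<le> G" if "t \<in> {z - (real n + 1) * h..z + (real n + 1) * h}" for t
  proof -
    have "\<bar>?g' t\<bar> \<le> M / fact n * \<bar>t - z\<bar> ^ n"
      using taylor_poly_remainder[of n "\<lambda>j. F (Suc j)" M t z] F M by simp
    also have "\<dots> \<le> G"
      unfolding G_def using \<open>M \<ge> 0\<close> that by (intro mult_left_mono power_mono) auto
    finally show ?thesis .
  qed
  have "\<bar>window_spline_deriv p q ?g z\<bar> \<le> qi_norm n w * G"
    unfolding window_spline_deriv_def
  proof (rule abs_convex_sum_le)
    have "\<eta> (p + int (n - 1)) \<le> \<eta> (p + int n)"
      using n_pos by (intro strict_mono_less_eq[OF strict_mono_knots, THEN iffD2]) simp
    then show "(\<Sum>k=p..q. bspline \<eta> (n - 1) k z) = 1"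
      using z by (intro sum_bspline_eq_1[OF strict_mono_knots]) auto
    fix k
    assume "bspline \<eta> (n - 1) k z \<noteq> 0"
    then have k: "\<eta> k \<le> z" "z \<le> \<eta> (k + int n)"
      using bspline_eq_0[OF strict_mono_knots, of z k "n - 1"] n_pos by (force simp: of_nat_diff)+
    have "node_functional k ?g - node_functional (k - 1) ?g =
        qi_functional \<eta> h n w k (\<lambda>t. ?g t - ?g (t - h))"
      by (simp add: qi_functional_def knots algebra_simps flip: sum_subtractf)
    also have "\<bar>\<dots>\<bar> \<le> qi_norm n w * (G * h)"
    proof (rule qi_functional_bound)
      fix v assume "v \<le> n"
      define t where "t = \<eta> (k + int v) + h / 2"
      have "h * real v \<le> h * real n" "0 \<le> h * real v" using \<open>v \<le> n\<close> h_pos by simp_all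
      moreover have "t = \<eta> k + h * real v + h / 2" "\<eta> (k + int n) = \<eta> k + h * real n"
        "(real n + 1) * h = h * real n + h"
        by (simp_all add: t_def knots algebra_simps)
      ultimately have t: "t \<in> {z - (real n + 1) * h..z + (real n + 1) * h}"
          "t - h \<in> {z - (real n + 1) * h..z + (real n + 1) * h}"
        using k h_pos unfolding atLeastAtMost_iff by linarith+
      have "norm (?g t - ?g (t - h)) \<le> G * norm (t - (t - h))"
        by (rule field_differentiable_bound[OF convex_real_interval(5)
              has_field_derivative_at_within[OF deriv_g] _ t])
          (use bound_g in simp)
      then show "\<bar>?g (\<eta> (k + int v) + h / 2) - ?g (\<eta> (k + int v) + h / 2 - h)\<bar> \<le> G * h"
        using h_pos unfolding t_def by simp
    qed
    finally show "\<bar>(node_functional k ?g - node_functional (k - 1) ?g) / h\<bar> \<le> qi_norm n w * G"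
      using h_pos by (simp add: divide_le_eq mult.assoc)
  qed (simp add: bspline_nonneg[OF strict_mono_knots])
  moreover have "window_spline_deriv p q ?g z =
      window_spline_deriv p q (F 0) z - window_spline_deriv p q ?P z"
    unfolding window_spline_deriv_def sum_subtractf[symmetric]
    by (intro sum.cong)
      (simp_all add: qi_functional_def algebra_simps sum_subtractf diff_divide_distrib add_divide_distrib)
  \<comment> \<open>The polynomial is reproduced in a neighbourhood of \<open>z\<close>, so its derivative is reproduced at \<open>z\<close>.\<close>
  moreover have "window_spline_deriv p q ?P z = F 1 z"
  proof -
    have "z \<noteq> \<eta> (p + int n)" using z(3) by auto
    then have "z \<in> {\<eta> (p + int n)<..<\<eta> (q + 1)}" using z(1,2) by simp
    moreover have "window_spline p q ?P y = ?P y" if "y \<in> {\<eta> (p + int n)<..<\<eta> (q + 1)}" for y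
      using that by (intro window_spline_taylor_poly) auto
    ultimately have "(?P has_field_derivative window_spline_deriv p q ?P z) (at z)"
      by (intro has_field_derivative_transform_within_open[OF
            window_spline_has_field_derivative[OF z, of ?P] open_greaterThanLessThan])
    moreover have "?P' z = F 1 z"
      using taylor_poly_self[of "\<lambda>j. F (Suc j)" "n - 1" z] n_pos by simp
    ultimately show ?thesis
      using DERIV_unique taylor_poly_has_field_derivative[of F n z z] by metis
  qed
  ultimately show ?thesis by (simp add: G_def)
qed

lemma continuous_on_window_spline: "continuous_on S (window_spline p q f)"
  unfolding window_spline_def[abs_def]
  by (intro continuous_intros continuous_on_bspline[OF strict_mono_knots n_pos])

text \<open>
The fundamental theorem of calculus with finitely many exceptional points lets the logarithmic
derivative be integrated across the knots.
\<close>
lemma ln_window_spline_lipschitz: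
  assumes "x \<le> y" and window: "\<eta> (p + int n) \<le> x" "y < \<eta> (q + 1)"
    and "a > 0" and lower: "\<And>z. z \<in> {x..y} \<Longrightarrow> a \<le> window_spline p q f z"
    and upper: "\<And>z. z \<in> {x..y} - range \<eta> \<Longrightarrow> \<bar>window_spline_deriv p q f z\<bar> \<le> L"
    and "L \<ge> 0"
  shows "\<bar>ln (window_spline p q f y) - ln (window_spline p q f x)\<bar> \<le> L / a * \<bar>x - y\<bar>"
proof -
  let ?S = "window_spline p q f"
  let ?D = "\<lambda>z. window_spline_deriv p q f z / ?S z"
  have pos: "?S z > 0" if "z \<in> {x..y}" for z using lower[OF that] \<open>a > 0\<close> by linarith
  have "(?D has_integral ln (?S y) - ln (?S x)) {x..y}"
  proof (rule fundamental_theorem_of_calculus_interior_strong[OF finite_knots[of x y] \<open>x \<le> y\<close>])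
    fix z assume z: "z \<in> {x<..<y} - range \<eta> \<inter> {x..y}"
    then have "(?S has_field_derivative window_spline_deriv p q f z) (at z)"
      using window by (intro window_spline_has_field_derivative) auto
    moreover have "?S z > 0" using pos z by simp
    ultimately have "((\<lambda>z. ln (?S z)) has_field_derivative ?D z) (at z)"
      using DERIV_chain2[OF DERIV_ln, where g = ?S] by (simp add: field_simps)
    then show "((\<lambda>z. ln (?S z)) has_vector_derivative ?D z) (at z)"
      by (simp add: has_real_derivative_iff_has_vector_derivative)
  next
    have "?S z \<noteq> 0" if "z \<in> {x..y}" for z using pos[OF that] by simp
    then show "continuous_on {x..y} (\<lambda>z. ln (?S z))"
      by (intro continuous_on_ln continuous_on_window_spline) auto
  qed
  moreover have "norm (?D z) \<le> L / a" if "z \<in> {x..y} - range \<eta> \<inter> {x..y}" for z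
  proof -
    have "\<bar>?D z\<bar> = \<bar>window_spline_deriv p q f z\<bar> / ?S z" using pos[of z] that by simp
    also have "\<dots> \<le> L / a"
      using that upper[of z] lower[of z] \<open>a > 0\<close> by (intro frac_le) auto
    finally show ?thesis by simp
  qed
  ultimately have "norm (ln (?S y) - ln (?S x)) \<le> L / a * measure lborel {x..y}"
    using \<open>L \<ge> 0\<close> \<open>a > 0\<close> by (intro has_integral_bound_real[OF _ finite_knots[of x y]]) auto
  then show ?thesis using \<open>x \<le> y\<close> by simp
qed

end

section \<open>The parameter interval\<close>

lemma uniform_knots_affine:
  assumes "uniform_knots \<xi> K n h"
  obtains c where "\<And>k. k \<in> K \<Longrightarrow> \<xi> k = c + h * of_int k"
proof -
  have step: "\<xi> (k + 1) = \<xi> k + h" if "k \<in> K" "k + 1 \<in> K" for k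
  proof -
    have "\<xi> (k + 1) - \<xi> k = h" using assms that unfolding uniform_knots_def by blast
    then show ?thesis by simp
  qed
  have between: "j \<in> K" if "i \<in> K" "k \<in> K" "i \<le> j" "j \<le> k" for i j k
    using assms that unfolding uniform_knots_def by auto
  have shift: "\<xi> (k + int m) = \<xi> k + h * real m" if "k \<in> K" "k + int m \<in> K" for k m
    using that(2)
  proof (induction m)
    case (Suc m)
    have "k + int m \<in> K" by (rule between[OF that(1) Suc.prems]) auto
    then show ?case using Suc.IH step[of "k + int m"] Suc.prems by (simp add: algebra_simps)
  qed simp
  have "K \<noteq> {}" using assms unfolding uniform_knots_def by auto
  then obtain k0 where "k0 \<in> K" by blast
  have "\<xi> k = (\<xi> k0 - h * of_int k0) + h * of_int k" if "k \<in> K" for k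
  proof (cases "k0 \<le> k")
    case True
    then show ?thesis using shift[of k0 "nat (k - k0)"] \<open>k0 \<in> K\<close> that by (simp add: algebra_simps)
  next
    case False
    then show ?thesis using shift[of k "nat (k0 - k)"] \<open>k0 \<in> K\<close> that by (simp add: algebra_simps)
  qed
  then show thesis by (rule that)
qed

context uniform_bsplines
begin

lemma knot_interval:
  obtains j where "\<eta> j \<le> x" "x < \<eta> (j + 1)"
proof -
  define j where "j = \<lfloor>(x - c) / h\<rfloor>"
  have "of_int j \<le> (x - c) / h" "(x - c) / h < of_int j + 1"
    unfolding j_def by linarith+
  then have "\<eta> j \<le> x" "x < \<eta> (j + 1)"
    using h_pos by (simp_all add: knots field_simps)
  then show thesis by (rule that)
qed

text \<open>
One window serves all points between \<open>x\<close> and \<open>y\<close>.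
\<close>
lemma window_exists:
  obtains p q where "\<eta> (p + int n) \<le> x" "y < \<eta> (q + 1)"
proof -
  obtain i j where "\<eta> i \<le> x" "y < \<eta> (j + 1)" using knot_interval[of x] knot_interval[of y] by metis
  then show thesis using that[of "i - int n" j] by simp
qed

text \<open>
On this set, sums over \<open>I\<close> miss no term of the corresponding sums over all integers. For the index
set of a knot sequence it turns out to be the parameter interval.
\<close>
definition complete_domain :: "int set \<Rightarrow> real set" where
  "complete_domain I = {x. \<forall>k. k \<notin> I \<longrightarrow> bspline \<eta> n k x = 0}"

lemma infsum_bspline:
  assumes "\<eta> (p + int n) \<le> x" "x < \<eta> (q + 1)"
  shows "(\<Sum>\<^sub>\<infinity>k\<in>I. d k * bspline \<eta> n k x) = (\<Sum>k\<in>{p..q} \<inter> I. d k * bspline \<eta> n k x)"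
proof -
  have "bspline \<eta> n k x = 0" if "k \<notin> {p..q}" for k
  proof (rule bspline_eq_0[OF strict_mono_knots])
    from that have "k + int n + 1 \<le> p + int n \<or> q + 1 \<le> k" by auto
    then have "\<eta> (k + int n + 1) \<le> \<eta> (p + int n) \<or> \<eta> (q + 1) \<le> \<eta> k"
      by (simp only: strict_mono_less_eq[OF strict_mono_knots])
    then show "x < \<eta> k \<or> \<eta> (k + int n + 1) \<le> x" using assms by linarith
  qed
  then have "(\<Sum>\<^sub>\<infinity>k\<in>I. d k * bspline \<eta> n k x) = (\<Sum>\<^sub>\<infinity>k\<in>{p..q} \<inter> I. d k * bspline \<eta> n k x)"
    by (intro infsum_cong_neutral) auto
  then show ?thesis by simp
qed

lemma infsum_bspline_complete:
  assumes "\<eta> (p + int n) \<le> x" "x < \<eta> (q + 1)" and "x \<in> complete_domain I"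
  shows "(\<Sum>\<^sub>\<infinity>k\<in>I. d k * bspline \<eta> n k x) = (\<Sum>k=p..q. d k * bspline \<eta> n k x)"
  unfolding infsum_bspline[OF assms(1,2)]
  by (rule sum.mono_neutral_left) (use assms(3) in \<open>auto simp: complete_domain_def\<close>)

text \<open>
All B-splines together sum to \<open>1\<close> and are nonnegative. So a partial sum equals \<open>1\<close> exactly if every
omitted term is \<open>0\<close>.
\<close>
lemma infsum_bspline_eq_1_iff:
  "(\<Sum>\<^sub>\<infinity>k\<in>I. bspline \<eta> n k x) = 1 \<longleftrightarrow> x \<in> complete_domain I"
proof
  assume "x \<in> complete_domain I"
  moreover obtain p q where pq: "\<eta> (p + int n) \<le> x" "x < \<eta> (q + 1)" by (rule window_exists)
  ultimately show "(\<Sum>\<^sub>\<infinity>k\<in>I. bspline \<eta> n k x) = 1"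
    using infsum_bspline_complete[OF pq, of I "\<lambda>_. 1"] sum_bspline_eq_1[OF strict_mono_knots pq] by simp
next
  assume sum_I: "(\<Sum>\<^sub>\<infinity>k\<in>I. bspline \<eta> n k x) = 1"
  show "x \<in> complete_domain I" unfolding complete_domain_def
  proof (intro CollectI allI impI)
    fix k assume "k \<notin> I"
    obtain p0 q0 where pq0: "\<eta> (p0 + int n) \<le> x" "x < \<eta> (q0 + 1)" by (rule window_exists)
    \<comment> \<open>The window is enlarged to contain \<open>k\<close>, so that the term of index \<open>k\<close> is among the omitted ones.\<close>
    define p q where "p = min p0 k" and "q = max q0 k"
    have "\<eta> (p + int n) \<le> \<eta> (p0 + int n)" "\<eta> (q0 + 1) \<le> \<eta> (q + 1)"
      by (simp_all add: strict_mono_less_eq[OF strict_mono_knots] p_def q_def)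
    then have pq: "\<eta> (p + int n) \<le> x" "x < \<eta> (q + 1)" using pq0 by linarith+
    have "(\<Sum>k\<in>{p..q} \<inter> I. bspline \<eta> n k x) = 1"
      using infsum_bspline[OF pq, of "\<lambda>_. 1" I] sum_I by simp
    then have "(\<Sum>k\<in>{p..q} - I. bspline \<eta> n k x) = 0"
      using sum_bspline_eq_1[OF strict_mono_knots pq] sum.Int_Diff[of "{p..q}" "\<lambda>k. bspline \<eta> n k x" I] by simp
    moreover have "k \<in> {p..q} - I" using \<open>k \<notin> I\<close> by (simp add: p_def q_def)
    ultimately show "bspline \<eta> n k x = 0"
      by (simp add: sum_nonneg_eq_0_iff bspline_nonneg[OF strict_mono_knots])
  qed
qed

text \<open>
To the left of \<open>\<eta> (a + n)\<close> some B-spline with index below \<open>a\<close> is positive, to the right of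
\<open>\<eta> (b + 1)\<close> some B-spline with index above \<open>b\<close>. The right end point is included because
continuous B-splines vanish at their leftmost knot.
\<close>
lemma complete_domain_finite:
  assumes "a \<le> b"
  shows "complete_domain {a..b} = {\<eta> (a + int n)..\<eta> (b + 1)}"
proof (intro equalityI subsetI)
  fix x assume "x \<in> complete_domain {a..b}"
  then have zero: "bspline \<eta> n k x = 0" if "k \<notin> {a..b}" for k
    using that unfolding complete_domain_def by blast
  have less_iff: "\<eta> i < \<eta> j \<longleftrightarrow> i < j" for i j by (rule strict_mono_less[OF strict_mono_knots])
  obtain j where j: "\<eta> j \<le> x" "x < \<eta> (j + 1)" by (rule knot_interval)
  have "\<eta> (a + int n) \<le> x"
  proof (rule ccontr)
    assume "\<not> \<eta> (a + int n) \<le> x"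
    then have "\<eta> j < \<eta> (a + int n)" using j by linarith
    then have "j < a + int n" by (simp only: less_iff)
    have "\<eta> (j - int n) < \<eta> j" using n_pos by (simp add: less_iff)
    then have "\<eta> (j - int n) < x" using j by linarith
    then show False
      using bspline_pos[OF strict_mono_knots, of "j - int n" x n] zero[of "j - int n"] j \<open>j < a + int n\<close> by simp
  qed
  moreover have "x \<le> \<eta> (b + 1)"
  proof (rule ccontr)
    assume x: "\<not> x \<le> \<eta> (b + 1)"
    then have "b + 1 \<le> j" using j less_iff[of "b + 1" "j + 1"] by linarith
    \<comment> \<open>If \<open>x\<close> is a knot, the B-spline that starts there vanishes, and its left neighbour is used.\<close>
    define k where "k = (if \<eta> j = x then j - 1 else j)"
    have "k \<ge> b + 1" using \<open>b + 1 \<le> j\<close> x by (cases "j = b + 1") (auto simp: k_def)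
    moreover have "\<eta> k < x" using j less_iff[of "j - 1" j] by (auto simp: k_def)
    moreover have "\<eta> (j + 1) \<le> \<eta> (k + int n + 1) \<or> \<eta> j = x \<and> \<eta> j < \<eta> (k + int n + 1)"
      using n_pos by (auto simp: k_def less_iff strict_mono_less_eq[OF strict_mono_knots])
    then have "x < \<eta> (k + int n + 1)" using j by auto
    ultimately show False using bspline_pos[OF strict_mono_knots, of k x n] zero[of k] by simp
  qed
  ultimately show "x \<in> {\<eta> (a + int n)..\<eta> (b + 1)}" by simp
next
  fix x assume x: "x \<in> {\<eta> (a + int n)..\<eta> (b + 1)}"
  show "x \<in> complete_domain {a..b}" unfolding complete_domain_def
  proof (intro CollectI allI impI)
    fix k assume "k \<notin> {a..b}"
    then consider "k + int n + 1 \<le> a + int n" | "b + 1 \<le> k" by force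
    then show "bspline \<eta> n k x = 0"
    proof cases
      case 1
      then have "\<eta> (k + int n + 1) \<le> \<eta> (a + int n)" by (simp only: strict_mono_less_eq[OF strict_mono_knots])
      then show ?thesis using x by (intro bspline_eq_0[OF strict_mono_knots]) auto
    next
      case 2
      then have "\<eta> (b + 1) \<le> \<eta> k" by (simp only: strict_mono_less_eq[OF strict_mono_knots])
      then have "x < \<eta> k \<or> x = \<eta> k" using x by auto
      then show ?thesis using bspline_eq_0[OF strict_mono_knots] bspline_left_knot[OF strict_mono_knots n_pos] by blast
    qed
  qed
qed

text \<open>
The sets on which the B-splines form a partition of unity are exactly the subsets of one set, and
that set is an interval; so it is the greatest such interval.
\<close>
lemma parameter_interval_eq:
  assumes \<xi>: "\<And>k. k \<in> K \<Longrightarrow> \<xi> k = \<eta> k"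
    and K: "K = UNIV \<or> (\<exists>a b. a + 2 * int n < b \<and> K = {a..b})"
  shows "parameter_interval \<xi> K n = complete_domain (bspline_indices K n)"
proof -
  let ?I = "bspline_indices K n"
  have "bspline \<xi> n k x = bspline \<eta> n k x" if "k \<in> ?I" for k x
    using that by (intro bspline_cong \<xi>) (auto simp: bspline_indices_def)
  then have "(\<Sum>\<^sub>\<infinity>k\<in>?I. bspline \<xi> n k x) = (\<Sum>\<^sub>\<infinity>k\<in>?I. bspline \<eta> n k x)"
    and "\<forall>k\<in>?I. 0 \<le> bspline \<xi> n k x" for x
    using bspline_nonneg[OF strict_mono_knots] by (auto intro: infsum_cong)
  then have pou: "partition_of_unity_on \<xi> K n J \<longleftrightarrow> J \<subseteq> complete_domain ?I" for J
    unfolding partition_of_unity_on_def by (auto simp: infsum_bspline_eq_1_iff)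
  have interval: "is_interval (complete_domain ?I)"
    using K
  proof (elim disjE exE conjE)
    assume "K = UNIV"
    then show ?thesis by (simp add: bspline_indices_def complete_domain_def)
  next
    fix a b assume "a + 2 * int n < b" and K: "K = {a..b}"
    have "?I = {a..b - int n - 1}" unfolding K bspline_indices_def by auto
    moreover have "complete_domain {a..b - int n - 1} = {\<eta> (a + int n)..\<eta> (b - int n - 1 + 1)}"
      using \<open>a + 2 * int n < b\<close> by (intro complete_domain_finite) simp
    ultimately show ?thesis by (simp add: is_interval_cc)
  qed
  show "parameter_interval \<xi> K n = complete_domain ?I"
    unfolding parameter_interval_def
    by (rule Greatest_equality) (use interval in \<open>auto simp: pou\<close>)
qed

end

lemma (in uniform_quasi_interpolation) quasi_interpolant_eq_window_spline:
  assumes \<xi>: "\<And>k. k \<in> K \<Longrightarrow> \<xi> k = \<eta> k"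
    and "\<eta> (p + int n) \<le> x" "x < \<eta> (q + 1)" and "x \<in> complete_domain (bspline_indices K n)"
  shows "quasi_interpolant \<xi> K h n w f x = window_spline p q f x"
proof -
  have "qi_functional \<xi> h n w k f * bspline \<xi> n k x = node_functional k f * bspline \<eta> n k x"
    if "k \<in> bspline_indices K n" for k
  proof -
    have "i \<in> K" if "k \<le> i" "i \<le> k + int n + 1" for i
      using that \<open>k \<in> bspline_indices K n\<close> by (auto simp: bspline_indices_def)
    then have "\<xi> i = \<eta> i" if "k \<le> i" "i \<le> k + int n + 1" for i using \<xi> that by blast
    then have "bspline \<xi> n k x = bspline \<eta> n k x" "qi_functional \<xi> h n w k f = node_functional k f"
      unfolding qi_functional_def by (auto intro!: bspline_cong sum.cong)
    then show ?thesis by simp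
  qed
  then have "quasi_interpolant \<xi> K h n w f x =
      (\<Sum>\<^sub>\<infinity>k\<in>bspline_indices K n. node_functional k f * bspline \<eta> n k x)"
    unfolding quasi_interpolant_def by (rule infsum_cong)
  then show ?thesis
    by (simp only: infsum_bspline_complete[OF assms(2-4)] window_spline_def)
qed

section \<open>Log-Lipschitz bound\<close>

lemma C2_const_eq:
  "C2_const n w f * h ^ (n + 1) = qi_norm n w *
    (sup_norm ((deriv ^^ Suc n) f) / fact (Suc n) * ((real n + 1) * h) ^ Suc n)"
proof -
  have "fact (Suc n) = (real n + 1) * fact n" by (simp add: algebra_simps)
  then show ?thesis by (simp add: C2_const_def power_mult_distrib del: fact_Suc)
qed

lemma qi_norm_nonneg: "qi_norm n w \<ge> 0"
  by (simp add: qi_norm_def sum_nonneg)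

text \<open>
The left-hand side is \<open>(n + 1) / (2 n)\<close> times the right-hand side.
\<close>
lemma C1_const_ge:
  assumes "n \<ge> 1" and "h > 0" and "sup_norm ((deriv ^^ Suc n) f) \<ge> 0"
  shows "qi_norm n w * (sup_norm ((deriv ^^ Suc n) f) / fact n * ((real n + 1) * h) ^ n) \<le>
    C1_const n w f * h ^ n"
proof -
  obtain m where n: "n = Suc m" using assms(1) by (cases n) auto
  define X where "X = (real n + 1) ^ m * qi_norm n w / fact m * sup_norm ((deriv ^^ Suc n) f) * h ^ n"
  have "X \<ge> 0" using assms(2,3) by (simp add: X_def qi_norm_nonneg)
  have "qi_norm n w * (sup_norm ((deriv ^^ Suc n) f) / fact n * ((real n + 1) * h) ^ n) =
      (real n + 1) / real n * X"
    by (simp add: X_def n power_mult_distrib)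
  also have "\<dots> \<le> 2 * X"
    using \<open>X \<ge> 0\<close> assms(1) by (intro mult_right_mono) (simp_all add: divide_le_eq)
  also have "\<dots> = C1_const n w f * h ^ n"
    by (simp add: C1_const_def X_def n)
  finally show ?thesis .
qed

lemma times_cont_diff_has_field_derivative:
  assumes "times_cont_diff m f" and "j < m"
  shows "((deriv ^^ j) f has_field_derivative (deriv ^^ Suc j) f x) (at x)"
  using assms by (simp add: times_cont_diff_def DERIV_deriv_iff_real_differentiable)

theorem theorem3p2:
  fixes n :: nat and f :: "real \<Rightarrow> real" and A B D h :: real
    and \<xi> :: "int \<Rightarrow> real" and K :: "int set" and w :: "nat \<Rightarrow> real"
  assumes "n \<ge> 1"
    and "times_cont_diff (n + 1) f"
    and "bounded (range ((deriv ^^ (n + 1)) f))"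
    and "A > 0" and "B > 0" and "D > 0"
    and "\<And>x. A \<le> f x \<and> f x \<le> B"
    and "\<And>x. \<bar>deriv f x\<bar> \<le> D * \<bar>f x\<bar>"
    and "uniform_knots \<xi> K n h"
    and "qi_weights n w"
    and "A - C2_const n w f * h ^ (n + 1) > 0"
  shows "(\<forall>x\<in>parameter_interval \<xi> K n. quasi_interpolant \<xi> K h n w f x > 0) \<and>
    (\<forall>x\<in>parameter_interval \<xi> K n. \<forall>y\<in>parameter_interval \<xi> K n.
       \<bar>ln (quasi_interpolant \<xi> K h n w f x) - ln (quasi_interpolant \<xi> K h n w f y)\<bar>
       \<le> (D * B + C1_const n w f * h ^ n) / (A - C2_const n w f * h ^ (n + 1)) * \<bar>x - y\<bar>)"
proof -
  define F where "F = (\<lambda>j. (deriv ^^ j) f)"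
  define M where "M = sup_norm (F (Suc n))"
  have h: "h > 0" and K: "K = UNIV \<or> (\<exists>a b. a + 2 * int n < b \<and> K = {a..b})"
    using assms(9) by (auto simp: uniform_knots_def)
  have F0: "F 0 = f" and F1: "F 1 = deriv f" by (simp_all add: F_def)
  have F: "(F j has_field_derivative F (Suc j) t) (at t)" if "j \<le> n" for j t
    unfolding F_def using that by (intro times_cont_diff_has_field_derivative[OF assms(2)]) simp
  have M: "\<bar>F (Suc n) t\<bar> \<le> M" for t
  proof -
    obtain C where "\<bar>F (Suc n) x\<bar> \<le> C" for x
      using assms(3) unfolding bounded_iff F_def by auto
    then have "bdd_above (range (\<lambda>x. \<bar>F (Suc n) x\<bar>))" by (intro bdd_aboveI[of _ C]) auto
    then show ?thesis unfolding M_def sup_norm_def by (intro cSUP_upper) auto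
  qed
  then have "M \<ge> 0" using M[of 0] by linarith
  obtain c where c: "\<And>k. k \<in> K \<Longrightarrow> \<xi> k = c + h * of_int k"
    using uniform_knots_affine[OF assms(9)] by blast
  define \<eta> where "\<eta> = (\<lambda>k. c + h * of_int k)"
  interpret uniform_quasi_interpolation \<eta> c h n w
    by unfold_locales (use assms(1,10) h in \<open>simp_all add: \<eta>_def\<close>)
  have \<xi>: "\<xi> k = \<eta> k" if "k \<in> K" for k using c[OF that] by (simp add: \<eta>_def)
  let ?Q = "quasi_interpolant \<xi> K h n w f" and ?J = "complete_domain (bspline_indices K n)"
  define a where "a = A - C2_const n w f * h ^ (n + 1)"
  define L where "L = D * B + C1_const n w f * h ^ n"
  have lower: "a \<le> window_spline p q f z" if "\<eta> (p + int n) \<le> z" "z < \<eta> (q + 1)" for p q z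
    using window_spline_error[of F M p z q, OF F M that] assms(7)[of z]
    unfolding a_def C2_const_eq F0 by (simp add: M_def F_def abs_le_iff)
  have upper: "\<bar>window_spline_deriv p q f z\<bar> \<le> L"
    if "\<eta> (p + int n) \<le> z" "z < \<eta> (q + 1)" "z \<notin> range \<eta>" for p q z
  proof -
    have "\<bar>window_spline_deriv p q f z - deriv f z\<bar> \<le> C1_const n w f * h ^ n"
      using window_spline_deriv_error[of F M p z q, OF F M that] C1_const_ge[OF assms(1) h, of f w] \<open>M \<ge> 0\<close>
      by (simp add: F0 F1[unfolded One_nat_def] M_def F_def)
    moreover have "\<bar>deriv f z\<bar> \<le> D * B"
      using assms(8)[of z] assms(7)[of z] assms(4,6)
      by (intro order.trans[OF assms(8)] mult_left_mono) auto
    ultimately show ?thesis unfolding L_def by linarith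
  qed
  have "C1_const n w f \<ge> 0"
    using \<open>M \<ge> 0\<close> by (simp add: C1_const_def qi_norm_nonneg M_def F_def)
  then have "L \<ge> 0" using assms(5,6) h by (simp add: L_def)
  have Q: "?Q z = window_spline p q f z"
    if "z \<in> ?J" "\<eta> (p + int n) \<le> z" "z < \<eta> (q + 1)" for p q z
    using that by (intro quasi_interpolant_eq_window_spline \<xi>)
  have pos: "?Q x > 0" if "x \<in> ?J" for x
  proof -
    obtain p q where pq: "\<eta> (p + int n) \<le> x" "x < \<eta> (q + 1)" by (rule window_exists)
    show ?thesis using lower[OF pq] assms(11) Q[OF that pq] unfolding a_def by linarith
  qed
  have lipschitz: "\<bar>ln (?Q y) - ln (?Q x)\<bar> \<le> L / a * \<bar>x - y\<bar>"
    if "x \<in> ?J" "y \<in> ?J" "x \<le> y" for x y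
  proof -
    obtain p q where pq: "\<eta> (p + int n) \<le> x" "y < \<eta> (q + 1)" by (rule window_exists)
    have "\<bar>ln (window_spline p q f y) - ln (window_spline p q f x)\<bar> \<le> L / a * \<bar>x - y\<bar>"
      using pq \<open>x \<le> y\<close> assms(11) \<open>L \<ge> 0\<close>
      by (intro ln_window_spline_lipschitz lower upper) (auto simp: a_def)
    then show ?thesis using Q[of x p q] Q[of y p q] that pq by simp
  qed
  have domain: "parameter_interval \<xi> K n = ?J"
    using \<xi> K by (rule parameter_interval_eq)
  have "\<bar>ln (?Q x) - ln (?Q y)\<bar> \<le> L / a * \<bar>x - y\<bar>" if "x \<in> ?J" "y \<in> ?J" for x y
    using lipschitz[of x y] lipschitz[of y x] that by (cases "x \<le> y") (auto simp: abs_minus_commute)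
  then show ?thesis
    using pos unfolding domain L_def a_def by blast
qed

end
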